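(* Let $n,N\in\mathbb N$, let $\widehat{\mathsf Q}_1,\dots,\widehat{\mathsf Q}_N\in\mathcal S^n$, let $\widehat{\mathbb P}_N=\frac1N\sum_{i=1}^N\delta_{\widehat{\mathsf Q}_i}$ be the empirical measure and $\overline{\mathsf Q}=\frac1N\sum_{i=1}^N\widehat{\mathsf Q}_i$ the sample mean. Let $p\ge1$, $\theta>0$, and let the norm on $\mathcal S^n$ be the Frobenius norm $\|\cdot\|_F$. Then, independently of $p$, $$\inf_{\mathbf x\in\Delta}\ \sup_{\mathbb P\in\mathbb B_{\theta,p}(\widehat{\mathbb P}_N)}\mathbb E_{\mathbb P}[\mathbf x^\top\widetilde{\mathsf Q}\mathbf x]=\min_{\mathbf x\in\Delta}\ \mathbf x^\top(\overline{\mathsf Q}+\theta\,\mathsf I)\mathbf x,$$ and for each $\mathbf x\in\Delta$ a worst-case distribution (an element of $\mathbb B_{\theta,p}(\widehat{\mathbb P}_N)$ attaining the inner supremum) is given by the push-forward $\mathbb P^*_{\mathbf x}=(T^{\mathbf x})_{\#}\widehat{\mathbb P}_N$ with $T^{\mathbf x}(\mathsf Z)=\mathsf Z+\frac{\theta}{\mathbf x^\top\mathbf x}\,\mathbf x\mathbf x^\top$.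
   Context: $\mathcal S^n$ is the space of real symmetric $n\times n$ matrices, $\mathsf I$ the identity matrix, $\Delta=\{\mathbf x\in\mathbb R^n:\mathbf x\ge\mathbf 0,\ \sum_i x_i=1\}$ the standard simplex. $\mathbb E_{\mathbb P}$ is expectation when the random symmetric matrix $\widetilde{\mathsf Q}$ has law $\mathbb P$, a Borel probability measure on $\mathcal S^n$. The $p$-Wasserstein distance is $W_p(\mathbb P,\mathbb P')=\big(\inf_{\pi\in\Pi(\mathbb P,\mathbb P')}\int\|\mathsf Q-\mathsf Q'\|_F^p\,\mathrm d\pi(\mathsf Q,\mathsf Q')\big)^{1/p}$, with $\Pi(\mathbb P,\mathbb P')$ the set of couplings, and $\mathbb B_{\theta,p}(\mathbb P')$ is the set of Borel probability measures $\mathbb P$ on $\mathcal S^n$ with $W_p(\mathbb P,\mathbb P')\le\theta$. *)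

theory Defs
  imports "HOL-Probability.Probability"
begin

definition sym_matrices :: "(real^'n^'n) set" where
  "sym_matrices = {A. transpose A = A}"

definition sym_borel :: "(real^'n^'n) measure" where
  "sym_borel = restrict_space borel sym_matrices"

lemma space_sym_borel [simp]: "space sym_borel = sym_matrices"
  by (simp add: sym_borel_def space_restrict_space)

text \<open>The library norm on \<^typ>\<open>real^'n^'m\<close> is the Frobenius norm.\<close>

lemma norm_eq_frobenius:
  fixes A :: "real^'n^'m"
  shows "norm A = sqrt (\<Sum>i\<in>UNIV. \<Sum>j\<in>UNIV. (A $ i $ j)\<^sup>2)"
  by (simp add: norm_vec_def L2_set_def sum_nonneg)

definition std_simplex :: "(real^'n) set" where
  "std_simplex = {x. (\<forall>i. 0 \<le> x $ i) \<and> (\<Sum>i\<in>UNIV. x $ i) = 1}"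

definition quad_form :: "real^'n^'n \<Rightarrow> real^'n \<Rightarrow> real" where
  "quad_form Q x = x \<bullet> (Q *v x)"

definition outer_square :: "real^'n \<Rightarrow> real^'n^'n" where
  "outer_square x = (\<chi> i j. x $ i * x $ j)"

definition sample_mean :: "nat \<Rightarrow> (nat \<Rightarrow> real^'n^'n) \<Rightarrow> real^'n^'n" where
  "sample_mean N Q = (1 / real N) *\<^sub>R (\<Sum>i=1..N. Q i)"

definition empirical_measure :: "nat \<Rightarrow> (nat \<Rightarrow> real^'n^'n) \<Rightarrow> (real^'n^'n) measure" where
  "empirical_measure N Q = measure_of (space sym_borel) (sets sym_borel)
     (\<lambda>A. ennreal (1 / real N) * (\<Sum>i=1..N. emeasure (return sym_borel (Q i)) A))"

lemma sets_empirical_measure [simp]: "sets (empirical_measure N Q) = sets sym_borel"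
  unfolding empirical_measure_def by (rule sets.sets_measure_of_eq)

lemma emeasure_empirical_measure:
  fixes Q :: "nat \<Rightarrow> real^'n^'n"
  assumes "A \<in> sets sym_borel"
  shows "emeasure (empirical_measure N Q) A =
    ennreal (1 / real N) * (\<Sum>i=1..N. emeasure (return sym_borel (Q i)) A)"
  unfolding empirical_measure_def
proof (rule emeasure_measure_of_sigma[OF _ _ _ assms])
  show "sigma_algebra (space sym_borel) (sets (sym_borel :: (real^'n^'n) measure))" ..
  show "positive (sets sym_borel)
     (\<lambda>A. ennreal (1 / real N) * (\<Sum>i=1..N. emeasure (return sym_borel (Q i)) A))"
    by (simp add: positive_def)
  show "countably_additive (sets sym_borel)
     (\<lambda>A. ennreal (1 / real N) * (\<Sum>i=1..N. emeasure (return sym_borel (Q i)) A))"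
  proof (rule countably_additiveI)
    fix F :: "nat \<Rightarrow> (real^'n^'n) set"
    assume F: "range F \<subseteq> sets sym_borel" "disjoint_family F"
    have "(\<Sum>k. emeasure (return sym_borel (Q i)) (F k)) =
        emeasure (return sym_borel (Q i)) (\<Union>k. F k)" for i
      using F by (intro suminf_emeasure) auto
    then show "(\<Sum>k. ennreal (1 / real N) * (\<Sum>i=1..N. emeasure (return sym_borel (Q i)) (F k))) =
        ennreal (1 / real N) * (\<Sum>i=1..N. emeasure (return sym_borel (Q i)) (\<Union>k. F k))"
      by (simp add: suminf_sum)
  qed
qed

text \<open>Powers with exponent \<open>a > 0\<close>, extended by \<open>\<infinity> powr a = \<infinity>\<close>.\<close>

definition ennreal_powr :: "ennreal \<Rightarrow> real \<Rightarrow> ennreal" where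
  "ennreal_powr c a = (if c = \<infinity> then \<infinity> else ennreal (enn2real c powr a))"

definition couplings ::
  "(real^'n^'n) measure \<Rightarrow> (real^'n^'n) measure \<Rightarrow> ((real^'n^'n) \<times> (real^'n^'n)) measure set" where
  "couplings P P' = {\<pi>. prob_space \<pi> \<and> sets \<pi> = sets (sym_borel \<Otimes>\<^sub>M sym_borel) \<and>
     distr \<pi> sym_borel fst = P \<and> distr \<pi> sym_borel snd = P'}"

definition wasserstein ::
  "real \<Rightarrow> (real^'n^'n) measure \<Rightarrow> (real^'n^'n) measure \<Rightarrow> ennreal" where
  "wasserstein p P P' = ennreal_powr
     (INF \<pi>\<in>couplings P P'. \<integral>\<^sup>+ (Q, Q'). ennreal (norm (Q - Q') powr p) \<partial>\<pi>) (1 / p)"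

definition wasserstein_ball ::
  "real \<Rightarrow> real \<Rightarrow> (real^'n^'n) measure \<Rightarrow> (real^'n^'n) measure set" where
  "wasserstein_ball \<theta> p P' = {P. prob_space P \<and> sets P = sets sym_borel \<and>
     wasserstein p P P' \<le> ennreal \<theta>}"

definition worst_case_map :: "real \<Rightarrow> real^'n \<Rightarrow> real^'n^'n \<Rightarrow> real^'n^'n" where
  "worst_case_map \<theta> x Z = Z + (\<theta> / (x \<bullet> x)) *\<^sub>R outer_square x"

end

theory Submission
  imports Defs
begin

text \<open>
  The objective is linear in the matrix: \<open>x\<^sup>T Q x\<close> is the Frobenius inner product of
  \<open>Q\<close> with \<open>x x\<^sup>T\<close>, a matrix of Frobenius norm \<open>x \<bullet> x\<close>. By Cauchy--Schwarz, moving mass from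
  \<open>Q'\<close> to \<open>Q\<close> changes the objective by at most \<open>(x \<bullet> x) \<parallel>Q - Q'\<parallel>\<close>, with equality when the
  displacement is a nonnegative multiple of \<open>x x\<^sup>T\<close>.

  For the upper bound, integrate this inequality over a nearly optimal coupling. Its mean displacement
  is at most its \<open>p\<close>-th order displacement (\<open>expectation_le_of_powr_moment\<close>), so no law at
  Wasserstein distance at most \<open>\<theta>\<close> from \<open>P'\<close> can raise the expectation by more than \<open>\<theta> (x \<bullet> x)\<close>
  (\<open>expectation_quad_form_le_on_ball\<close>). The exponent \<open>p\<close> disappears at this point.

  For the lower bound, the worst-case map moves every matrix by the same matrix, a positive multiple of
  \<open>x x\<^sup>T\<close> of norm \<open>\<theta>\<close>. As all displacements have the same length, the coupling along this map
  costs exactly \<open>\<theta>\<^sup>p\<close> for every \<open>p\<close>, and Cauchy--Schwarz is tight throughout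
  (\<open>worst_case_in_ball\<close>, \<open>integral_quad_form_worst_case\<close>). Hence the inner supremum over the ball
  equals the expectation under \<open>P'\<close> plus \<open>\<theta> (x \<bullet> x)\<close>.

  Under the empirical measure that expectation is the quadratic form of the sample mean, and
  \<open>\<theta> (x \<bullet> x)\<close> is the quadratic form of \<open>\<theta> I\<close>. The minimum over \<open>x\<close> is attained because the simplex
  is compact.
\<close>

section \<open>Quadratic forms as inner products\<close>

lemma quad_form_eq_inner: "quad_form Q x = Q \<bullet> outer_square x"
  by (simp add: quad_form_def outer_square_def inner_vec_def matrix_vector_mult_def
      sum_distrib_left mult_ac)

lemma inner_outer_square: "outer_square x \<bullet> outer_square x = (x \<bullet> x)\<^sup>2"
  by (simp add: outer_square_def inner_vec_def power2_eq_square sum_product mult_ac)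

lemma norm_outer_square: "norm (outer_square x) = x \<bullet> x"
  by (simp add: norm_eq_sqrt_inner[of "outer_square x"] inner_outer_square)

lemma transpose_outer_square: "transpose (outer_square x) = outer_square x"
  by (simp add: outer_square_def transpose_def vec_eq_iff mult.commute)

lemma abs_quad_form_diff_le:
  "\<bar>quad_form Q x - quad_form Q' x\<bar> \<le> (x \<bullet> x) * norm (Q - Q')"
  using Cauchy_Schwarz_ineq2[of "Q - Q'" "outer_square x"]
  by (simp add: quad_form_eq_inner inner_diff_left norm_outer_square mult.commute)

lemma quad_form_add_scaled_identity:
  "quad_form (A + c *\<^sub>R mat 1) x = quad_form A x + c * (x \<bullet> x)"
  by (simp add: quad_form_def matrix_vector_mult_add_rdistrib inner_add_right
      scaleR_matrix_vector_assoc[symmetric])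

lemma quad_form_sample_mean:
  "quad_form (sample_mean N Q) x = (\<Sum>i=1..N. quad_form (Q i) x) / real N"
  by (simp add: quad_form_eq_inner sample_mean_def inner_sum_left)

lemma quad_form_worst_case_map:
  assumes "x \<noteq> 0"
  shows "quad_form (worst_case_map \<theta> x Z) x = quad_form Z x + \<theta> * (x \<bullet> x)"
  using assms
  by (simp add: quad_form_eq_inner worst_case_map_def inner_add_left inner_outer_square
      power2_eq_square)

lemma norm_worst_case_map_diff:
  assumes "x \<noteq> 0" "\<theta> \<ge> 0"
  shows "norm (worst_case_map \<theta> x Z - Z) = \<theta>"
  using assms by (simp add: worst_case_map_def norm_outer_square)

section \<open>Measurability on the space of symmetric matrices\<close>

lemma measurable_sym_borel_id [measurable]: "(\<lambda>Q. Q) \<in> borel_measurable sym_borel"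
  unfolding sym_borel_def by (rule measurable_restrict_space1) simp

lemma borel_measurable_quad_form [measurable]:
  "(\<lambda>Q. quad_form Q x) \<in> borel_measurable sym_borel"
  unfolding quad_form_eq_inner by measurable

lemma borel_measurable_norm_fst_minus_snd [measurable]:
  "(\<lambda>z. norm (fst z - snd z :: real^'n^'n)) \<in> borel_measurable (sym_borel \<Otimes>\<^sub>M sym_borel)"
proof -
  note [measurable] = measurable_compose[OF measurable_fst measurable_sym_borel_id]
    measurable_compose[OF measurable_snd measurable_sym_borel_id]
  show ?thesis by measurable
qed

lemma measurable_worst_case_map [measurable]:
  "worst_case_map \<theta> x \<in> sym_borel \<rightarrow>\<^sub>M sym_borel"
proof -
  have "transpose (worst_case_map \<theta> x Z) = worst_case_map \<theta> x Z" if "transpose Z = Z" for Z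
  proof -
    have "transpose (worst_case_map \<theta> x Z)
        = transpose Z + (\<theta> / (x \<bullet> x)) *\<^sub>R transpose (outer_square x)"
      by (simp add: worst_case_map_def transpose_def vec_eq_iff)
    then show ?thesis
      by (simp add: that transpose_outer_square worst_case_map_def)
  qed
  moreover have "worst_case_map \<theta> x \<in> borel_measurable sym_borel"
    unfolding worst_case_map_def by measurable
  ultimately show ?thesis
    by (subst (2) sym_borel_def)
       (rule measurable_restrict_space2, auto simp: sym_matrices_def)
qed

section \<open>The upper bound over a Wasserstein ball\<close>

text \<open>
  Monotonicity of moments in the form needed for couplings, whose cost may a priori be infinite:
  the finite \<open>p\<close>-th moment is what makes the first moment exist. Young's inequality
  at scale \<open>a\<close> bounds \<open>X\<close> by an affine function of \<open>X\<^sup>p\<close> that is tight at \<open>X = a\<close>.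
\<close>

lemma expectation_le_of_powr_moment:
  fixes X :: "'a \<Rightarrow> real"
  assumes "prob_space M" and [measurable]: "X \<in> borel_measurable M"
    and X0: "\<And>z. 0 \<le> X z" and "p \<ge> 1" "a > 0"
    and moment: "(\<integral>\<^sup>+z. ennreal (X z powr p) \<partial>M) \<le> ennreal (a powr p)"
  shows "integrable M X" "(\<integral>z. X z \<partial>M) \<le> a"
proof -
  interpret prob_space M by fact
  have powr_int: "integrable M (\<lambda>z. X z powr p)"
    using le_less_trans[OF moment] by (intro integrableI_nonneg) auto
  have "ennreal (\<integral>z. X z powr p \<partial>M) \<le> ennreal (a powr p)"
    using moment by (subst nn_integral_eq_integral[symmetric]) (use powr_int in auto)
  then have powr_le: "(\<integral>z. X z powr p \<partial>M) \<le> a powr p"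
    by simp
  define Y where "Y z = ((1 / p) * (X z powr p) + (1 - 1 / p) * (a powr p)) / a powr (p - 1)" for z
  have Y_int: "integrable M Y"
    unfolding Y_def using powr_int by simp
  have "X z \<le> Y z" for z
  proof (cases "X z = 0")
    case True
    then show ?thesis using \<open>p \<ge> 1\<close> \<open>a > 0\<close> by (simp add: Y_def)
  next
    case False
    then have "X z > 0" using X0[of z] by simp
    then have "(X z powr p) powr (1 / p) * (a powr p) powr (1 - 1 / p)
        \<le> (1 / p) * (X z powr p) + (1 - 1 / p) * (a powr p)"
      using \<open>p \<ge> 1\<close> \<open>a > 0\<close> by (intro Youngs_inequality_0) auto
    moreover have "p * (1 - 1 / p) = p - 1"
      using \<open>p \<ge> 1\<close> by (simp add: field_simps)
    ultimately show ?thesis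
      using \<open>X z > 0\<close> \<open>p \<ge> 1\<close> \<open>a > 0\<close> by (simp add: Y_def powr_powr pos_le_divide_eq)
  qed
  note X_le_Y = this
  show X_int: "integrable M X"
    by (rule Bochner_Integration.integrable_bound[OF Y_int])
       (use X0 X_le_Y in \<open>auto intro!: AE_I2 order_trans[OF _ abs_ge_self]\<close>)
  have "(\<integral>z. X z \<partial>M) \<le> (\<integral>z. Y z \<partial>M)"
    using X_int Y_int X_le_Y by (rule integral_mono)
  also have "\<dots> = ((1 / p) * (\<integral>z. X z powr p \<partial>M) + (1 - 1 / p) * (a powr p)) / a powr (p - 1)"
    unfolding Y_def using powr_int by (simp add: prob_space)
  also have "\<dots> \<le> ((1 / p) * (a powr p) + (1 - 1 / p) * (a powr p)) / a powr (p - 1)"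
    using powr_le \<open>p \<ge> 1\<close> by (intro divide_right_mono add_right_mono mult_left_mono) auto
  also have "\<dots> = a powr p / a powr (p - 1)"
    by (simp add: algebra_simps)
  also have "\<dots> = a"
    using \<open>a > 0\<close> by (simp flip: powr_diff)
  finally show "(\<integral>z. X z \<partial>M) \<le> a" .
qed

lemma expectation_quad_form_le_of_coupling:
  fixes P P' :: "(real^'n^'n) measure"
  assumes \<pi>: "\<pi> \<in> couplings P P'" and "p \<ge> 1" "a > 0"
    and cost: "(\<integral>\<^sup>+ (Q, Q'). ennreal (norm (Q - Q') powr p) \<partial>\<pi>) \<le> ennreal (a powr p)"
    and P'_int: "integrable P' (\<lambda>Q. quad_form Q x)"
  shows "(\<integral>Q. quad_form Q x \<partial>P) \<le> (\<integral>Q. quad_form Q x \<partial>P') + a * (x \<bullet> x)"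
proof -
  have "prob_space \<pi>" and sets_\<pi> [measurable_cong]: "sets \<pi> = sets (sym_borel \<Otimes>\<^sub>M sym_borel)"
    and P: "P = distr \<pi> sym_borel fst" and P': "P' = distr \<pi> sym_borel snd"
    using \<pi> by (auto simp: couplings_def)
  have fst_meas [measurable]: "fst \<in> \<pi> \<rightarrow>\<^sub>M sym_borel"
    and snd_meas [measurable]: "snd \<in> \<pi> \<rightarrow>\<^sub>M sym_borel"
    by measurable
  let ?d = "\<lambda>z::(real^'n^'n) \<times> (real^'n^'n). norm (fst z - snd z)"
  let ?g = "\<lambda>z::(real^'n^'n) \<times> (real^'n^'n). quad_form (fst z) x - quad_form (snd z) x"
  have "(\<integral>\<^sup>+z. ennreal (?d z powr p) \<partial>\<pi>) \<le> ennreal (a powr p)"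
    using cost by (simp add: case_prod_unfold)
  note d = expectation_le_of_powr_moment[OF \<open>prob_space \<pi>\<close> _ _ \<open>p \<ge> 1\<close> \<open>a > 0\<close> this]
  have d_int: "integrable \<pi> ?d" and d_le: "(\<integral>z. ?d z \<partial>\<pi>) \<le> a"
    by (rule d; measurable; simp)+
  have snd_int: "integrable \<pi> (\<lambda>z. quad_form (snd z) x)"
    using P'_int unfolding P' by (simp add: integrable_distr_eq)
  have g_int: "integrable \<pi> ?g"
    by (rule Bochner_Integration.integrable_bound[OF integrable_mult_right[OF d_int, of "x \<bullet> x"]])
       (auto intro!: AE_I2 abs_quad_form_diff_le)
  \<comment> \<open>Integrability of the first marginal follows from that of the second and of the difference;
    without it the integral under \<open>P\<close> would be the default value \<open>0\<close>.\<close>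
  have "(\<integral>Q. quad_form Q x \<partial>P) = (\<integral>z. quad_form (snd z) x + ?g z \<partial>\<pi>)"
    unfolding P by (simp add: integral_distr)
  also have "\<dots> = (\<integral>z. quad_form (snd z) x \<partial>\<pi>) + (\<integral>z. ?g z \<partial>\<pi>)"
    using snd_int g_int by (rule Bochner_Integration.integral_add)
  also have "(\<integral>z. quad_form (snd z) x \<partial>\<pi>) = (\<integral>Q. quad_form Q x \<partial>P')"
    unfolding P' by (simp add: integral_distr)
  also have "(\<integral>z. ?g z \<partial>\<pi>) \<le> (\<integral>z. (x \<bullet> x) * ?d z \<partial>\<pi>)"
    using g_int d_int
    by (intro integral_mono) (auto intro: order_trans[OF abs_ge_self abs_quad_form_diff_le])
  also have "\<dots> \<le> a * (x \<bullet> x)"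
    using mult_left_mono[OF d_le, of "x \<bullet> x"] by (simp add: mult.commute)
  finally show ?thesis by simp
qed

lemma coupling_cost_le_of_wasserstein_le:
  assumes W: "wasserstein p P P' \<le> ennreal \<theta>" and "p > 0" "0 \<le> \<theta>" "\<theta> < a"
  obtains \<pi> where "\<pi> \<in> couplings P P'"
    and "(\<integral>\<^sup>+ (Q, Q'). ennreal (norm (Q - Q') powr p) \<partial>\<pi>) \<le> ennreal (a powr p)"
proof -
  let ?cost = "\<lambda>\<pi>. \<integral>\<^sup>+ (Q, Q'). ennreal (norm (Q - Q') powr p) \<partial>\<pi>"
  define c where "c = (INF \<pi>\<in>couplings P P'. ?cost \<pi>)"
  have "c \<noteq> \<infinity>" and root: "enn2real c powr (1 / p) \<le> \<theta>"
    using W \<open>0 \<le> \<theta>\<close> by (auto simp: wasserstein_def c_def[symmetric] ennreal_powr_def top_unique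
        split: if_splits)
  have "enn2real c = (enn2real c powr (1 / p)) powr p"
    using \<open>p > 0\<close> by (simp add: powr_powr)
  also have "\<dots> \<le> \<theta> powr p"
    using root \<open>p > 0\<close> by (intro powr_mono2) auto
  also have "\<dots> < a powr p"
    using assms by (intro powr_less_mono2) auto
  finally have "ennreal (enn2real c) < ennreal (a powr p)"
    by (simp add: ennreal_less_iff)
  then have "c < ennreal (a powr p)"
    using \<open>c \<noteq> \<infinity>\<close> by (simp add: top.not_eq_extremum)
  then show thesis
    using that unfolding c_def INF_less_iff by (meson less_imp_le)
qed

text \<open>
  The infimum defining the distance need not be attained a priori, so the bound is proved for every
  radius \<open>a > \<theta>\<close>, where a coupling exists, and then \<open>a\<close> tends to \<open>\<theta>\<close>.
\<close>

lemma expectation_quad_form_le_on_ball: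
  assumes P: "P \<in> wasserstein_ball \<theta> p P'" and "p \<ge> 1" "\<theta> \<ge> 0"
    and P'_int: "integrable P' (\<lambda>Q. quad_form Q x)"
  shows "(\<integral>Q. quad_form Q x \<partial>P) \<le> (\<integral>Q. quad_form Q x \<partial>P') + \<theta> * (x \<bullet> x)"
proof -
  have bound: "(\<integral>Q. quad_form Q x \<partial>P) \<le> (\<integral>Q. quad_form Q x \<partial>P') + a * (x \<bullet> x)" if less: "\<theta> < a" for a
  proof -
    have "wasserstein p P P' \<le> ennreal \<theta>"
      using P by (simp add: wasserstein_ball_def)
    then obtain \<pi> where "\<pi> \<in> couplings P P'"
      "(\<integral>\<^sup>+ (Q, Q'). ennreal (norm (Q - Q') powr p) \<partial>\<pi>) \<le> ennreal (a powr p)"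
      by (rule coupling_cost_le_of_wasserstein_le[OF _ _ \<open>\<theta> \<ge> 0\<close> less]) (use \<open>p \<ge> 1\<close> in auto)
    then show ?thesis
      using expectation_quad_form_le_of_coupling[of \<pi> P P' p a x] less assms by auto
  qed
  have "((\<lambda>a. (\<integral>Q. quad_form Q x \<partial>P') + a * (x \<bullet> x))
      \<longlongrightarrow> (\<integral>Q. quad_form Q x \<partial>P') + \<theta> * (x \<bullet> x)) (at_right \<theta>)"
    by (intro tendsto_intros)
  then show ?thesis
    by (rule tendsto_lowerbound)
       (auto intro!: eventually_at_right_less[THEN eventually_mono] bound)
qed

section \<open>The worst-case map attains the bound\<close>

lemma worst_case_in_ball:
  fixes P' :: "(real^'n^'n) measure"
  assumes "prob_space P'" and sets_P' [measurable_cong]: "sets P' = sets sym_borel"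
    and "x \<noteq> 0" "p > 0" "\<theta> \<ge> 0"
  shows "distr P' sym_borel (worst_case_map \<theta> x) \<in> wasserstein_ball \<theta> p P'"
proof -
  interpret prob_space P' by fact
  let ?T = "worst_case_map \<theta> x"
  define h where "h Z = (?T Z, Z)" for Z
  define \<pi> where "\<pi> = distr P' (sym_borel \<Otimes>\<^sub>M sym_borel) h"
  have T [measurable]: "?T \<in> P' \<rightarrow>\<^sub>M sym_borel"
    by (simp cong: measurable_cong_sets[OF sets_P' refl])
  have h [measurable]: "h \<in> P' \<rightarrow>\<^sub>M sym_borel \<Otimes>\<^sub>M sym_borel"
    unfolding h_def by measurable
  have "distr P' sym_borel (\<lambda>Z. Z) = P'"
    by (rule distr_id2) (simp add: sets_P')
  then have "\<pi> \<in> couplings (distr P' sym_borel ?T) P'"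
    unfolding couplings_def \<pi>_def
    by (simp add: prob_space_distr distr_distr comp_def) (simp add: h_def)
  moreover have "(\<integral>\<^sup>+ (Q, Q'). ennreal (norm (Q - Q') powr p) \<partial>\<pi>) = ennreal (\<theta> powr p)"
  proof -
    have "(\<integral>\<^sup>+ (Q, Q'). ennreal (norm (Q - Q') powr p) \<partial>\<pi>)
        = (\<integral>\<^sup>+ Z. ennreal (norm (?T Z - Z) powr p) \<partial>P')"
      unfolding \<pi>_def case_prod_unfold by (subst nn_integral_distr) (simp_all add: h_def)
    then show ?thesis
      using assms by (simp add: norm_worst_case_map_diff emeasure_space_1)
  qed
  ultimately have le: "(INF \<pi>\<in>couplings (distr P' sym_borel ?T) P'.
      \<integral>\<^sup>+ (Q, Q'). ennreal (norm (Q - Q') powr p) \<partial>\<pi>) \<le> ennreal (\<theta> powr p)" (is "?c \<le> _")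
    by (metis (no_types, lifting) INF_lower)
  then have "?c \<noteq> \<infinity>"
    unfolding infinity_ennreal_def by (rule neq_top_trans[OF ennreal_neq_top])
  moreover have "enn2real ?c powr (1 / p) \<le> \<theta>"
  proof -
    have "enn2real ?c powr (1 / p) \<le> (\<theta> powr p) powr (1 / p)"
      using enn2real_mono[OF le] \<open>p > 0\<close> by (intro powr_mono2) auto
    then show ?thesis
      using assms by (simp add: powr_powr)
  qed
  ultimately have "wasserstein p (distr P' sym_borel ?T) P' \<le> ennreal \<theta>"
    by (simp only: wasserstein_def ennreal_powr_def if_False ennreal_leI)
  then show ?thesis
    by (simp add: wasserstein_ball_def prob_space_distr)
qed

lemma integral_quad_form_worst_case:
  assumes "prob_space P'" and sets_P' [measurable_cong]: "sets P' = sets sym_borel"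
    and "x \<noteq> 0" and P'_int: "integrable P' (\<lambda>Q. quad_form Q x)"
  shows "(\<integral>Q. quad_form Q x \<partial>distr P' sym_borel (worst_case_map \<theta> x))
    = (\<integral>Q. quad_form Q x \<partial>P') + \<theta> * (x \<bullet> x)"
proof -
  interpret prob_space P' by fact
  have [measurable]: "worst_case_map \<theta> x \<in> P' \<rightarrow>\<^sub>M sym_borel"
    by (simp cong: measurable_cong_sets[OF sets_P' refl])
  show ?thesis
    using P'_int \<open>x \<noteq> 0\<close> by (simp add: integral_distr quad_form_worst_case_map prob_space)
qed

lemma SUP_expectation_quad_form_on_ball:
  assumes "prob_space P'" "sets P' = sets sym_borel"
    and "x \<noteq> 0" "p \<ge> 1" "\<theta> \<ge> 0" and "integrable P' (\<lambda>Q. quad_form Q x)"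
  shows "(SUP P\<in>wasserstein_ball \<theta> p P'. ereal (\<integral>Q. quad_form Q x \<partial>P))
    = ereal ((\<integral>Q. quad_form Q x \<partial>P') + \<theta> * (x \<bullet> x))"
proof (rule antisym)
  show "(SUP P\<in>wasserstein_ball \<theta> p P'. ereal (\<integral>Q. quad_form Q x \<partial>P))
      \<le> ereal ((\<integral>Q. quad_form Q x \<partial>P') + \<theta> * (x \<bullet> x))"
    using assms by (intro SUP_least) (simp add: expectation_quad_form_le_on_ball)
  have "ereal (\<integral>Q. quad_form Q x \<partial>distr P' sym_borel (worst_case_map \<theta> x))
      \<le> (SUP P\<in>wasserstein_ball \<theta> p P'. ereal (\<integral>Q. quad_form Q x \<partial>P))"
    using assms by (intro SUP_upper worst_case_in_ball) auto
  then show "ereal ((\<integral>Q. quad_form Q x \<partial>P') + \<theta> * (x \<bullet> x))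
      \<le> (SUP P\<in>wasserstein_ball \<theta> p P'. ereal (\<integral>Q. quad_form Q x \<partial>P))"
    using assms by (simp add: integral_quad_form_worst_case)
qed

section \<open>The empirical measure and the simplex\<close>

text \<open>
  As the law of a uniformly chosen index's sample, the empirical measure inherits total mass one and
  finite sums as integrals from the uniform measure on the indices.
\<close>

lemma empirical_measure_eq_distr:
  fixes Q :: "nat \<Rightarrow> real^'n^'n"
  assumes "N \<ge> 1" and Q: "\<And>i. i \<in> {1..N} \<Longrightarrow> Q i \<in> sym_matrices"
  shows "empirical_measure N Q = distr (uniform_count_measure {1..N}) sym_borel Q"
proof (rule measure_eqI)
  fix A assume "A \<in> sets (empirical_measure N Q)"
  then have A: "A \<in> sets sym_borel" by simp
  have Q_meas: "Q \<in> uniform_count_measure {1..N} \<rightarrow>\<^sub>M sym_borel"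
    using Q by (auto simp: uniform_count_measure_def)
  let ?I = "{i\<in>{1..N}. Q i \<in> A}"
  have "(\<Sum>i=1..N. emeasure (return sym_borel (Q i)) A) = (\<Sum>i=1..N. ennreal (of_bool (Q i \<in> A)))"
    using A by (intro sum.cong) (auto simp: indicator_def)
  also have "\<dots> = ennreal (real (card ?I))"
    by (subst sum_ennreal) (auto simp: sum.If_cases of_bool_def Int_def)
  finally have "emeasure (empirical_measure N Q) A = ennreal (real (card ?I) / real N)"
    using A by (simp add: emeasure_empirical_measure ennreal_mult[symmetric])
  moreover have "Q -` A \<inter> space (uniform_count_measure {1..N}) = ?I"
    by (auto simp: space_uniform_count_measure)
  then have "emeasure (distr (uniform_count_measure {1..N}) sym_borel Q) A
      = ennreal (real (card ?I) / real N)"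
    using A Q_meas by (simp only: emeasure_distr) (subst emeasure_uniform_count_measure; auto)
  ultimately show "emeasure (empirical_measure N Q) A
      = emeasure (distr (uniform_count_measure {1..N}) sym_borel Q) A"
    by simp
qed simp

lemma
  fixes Q :: "nat \<Rightarrow> real^'n^'n"
  assumes "N \<ge> 1" and Q: "\<And>i. i \<in> {1..N} \<Longrightarrow> Q i \<in> sym_matrices"
  shows prob_space_empirical_measure: "prob_space (empirical_measure N Q)"
    and integrable_quad_form_empirical_measure:
      "integrable (empirical_measure N Q) (\<lambda>Z. quad_form Z x)"
    and integral_quad_form_empirical_measure:
      "(\<integral>Z. quad_form Z x \<partial>empirical_measure N Q) = quad_form (sample_mean N Q) x"
proof -
  have emp: "empirical_measure N Q = distr (uniform_count_measure {1..N}) sym_borel Q"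
    using assms by (rule empirical_measure_eq_distr)
  have Q_meas: "Q \<in> uniform_count_measure {1..N} \<rightarrow>\<^sub>M sym_borel"
    using Q by (auto simp: uniform_count_measure_def)
  have "prob_space (uniform_count_measure {1..N})"
    using \<open>N \<ge> 1\<close> by (intro prob_space_uniform_count_measure) auto
  then show "prob_space (empirical_measure N Q)"
    unfolding emp using Q_meas by (rule prob_space.prob_space_distr)
  show "integrable (empirical_measure N Q) (\<lambda>Z. quad_form Z x)"
    unfolding emp integrable_distr_eq[OF Q_meas borel_measurable_quad_form]
    by (simp add: uniform_count_measure_def integrable_point_measure_finite)
  show "(\<integral>Z. quad_form Z x \<partial>empirical_measure N Q) = quad_form (sample_mean N Q) x"
    unfolding emp integral_distr[OF Q_meas borel_measurable_quad_form]
    by (simp add: integral_uniform_count_measure quad_form_sample_mean)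
qed

lemma zero_notin_std_simplex: "0 \<notin> std_simplex"
  by (simp add: std_simplex_def)

lemma std_simplex_nonempty: "(std_simplex :: (real^'n) set) \<noteq> {}"
proof -
  have "(\<chi> i. 1 / real CARD('n)) \<in> (std_simplex :: (real^'n) set)"
    by (simp add: std_simplex_def)
  then show ?thesis by blast
qed

lemma compact_std_simplex: "compact (std_simplex :: (real^'n) set)"
proof (rule compact_eq_bounded_closed[THEN iffD2], intro conjI)
  have "norm x \<le> 1" if "x \<in> std_simplex" for x :: "real^'n"
    using norm_le_l1_cart[of x] that by (simp add: std_simplex_def)
  then show "bounded (std_simplex :: (real^'n) set)"
    by (rule boundedI)
  have "closed ((\<Inter>i. {x::real^'n. 0 \<le> x $ i}) \<inter> {x. (\<Sum>i\<in>UNIV. x $ i) = 1})"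
    by (intro closed_Int closed_INT ballI closed_Collect_le closed_Collect_eq continuous_intros)
  also have "(\<Inter>i. {x::real^'n. 0 \<le> x $ i}) \<inter> {x. (\<Sum>i\<in>UNIV. x $ i) = 1} = std_simplex"
    by (auto simp: std_simplex_def)
  finally show "closed (std_simplex :: (real^'n) set)" .
qed

lemma quad_form_attains_min_on_std_simplex:
  "\<exists>y\<in>std_simplex. \<forall>x\<in>std_simplex. quad_form A y \<le> quad_form A x"
  unfolding quad_form_def
  by (intro continuous_attains_inf compact_std_simplex std_simplex_nonempty continuous_on_inner
      continuous_on_id linear_continuous_on matrix_vector_mul_bounded_linear)

section \<open>The robust standard quadratic program\<close>

theorem theorem3p2:
  fixes Qhat :: "nat \<Rightarrow> real^'n^'n" and N :: nat and p \<theta> :: real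
  assumes "N \<ge> 1"
    and "\<And>i. i \<in> {1..N} \<Longrightarrow> Qhat i \<in> sym_matrices"
    and "p \<ge> 1" and "\<theta> > 0"
  shows "(\<exists>y\<in>std_simplex.
        (\<forall>x\<in>std_simplex. quad_form (sample_mean N Qhat + \<theta> *\<^sub>R mat 1) y
           \<le> quad_form (sample_mean N Qhat + \<theta> *\<^sub>R mat 1) x) \<and>
        (INF x\<in>std_simplex. SUP P\<in>wasserstein_ball \<theta> p (empirical_measure N Qhat).
           ereal (\<integral>Q. quad_form Q x \<partial>P))
        = ereal (quad_form (sample_mean N Qhat + \<theta> *\<^sub>R mat 1) y))
    \<and> (\<forall>x\<in>std_simplex.
        distr (empirical_measure N Qhat) sym_borel (worst_case_map \<theta> x)
          \<in> wasserstein_ball \<theta> p (empirical_measure N Qhat) \<and>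
        ereal (\<integral>Q. quad_form Q x
          \<partial>distr (empirical_measure N Qhat) sym_borel (worst_case_map \<theta> x))
        = (SUP P\<in>wasserstein_ball \<theta> p (empirical_measure N Qhat).
             ereal (\<integral>Q. quad_form Q x \<partial>P)))"
proof -
  let ?E = "empirical_measure N Qhat" and ?A = "sample_mean N Qhat + \<theta> *\<^sub>R mat 1"
  note emp = prob_space_empirical_measure[OF assms(1,2)]
    integrable_quad_form_empirical_measure[OF assms(1,2)]
    integral_quad_form_empirical_measure[OF assms(1,2)]
  have nonzero: "x \<noteq> 0" if "x \<in> std_simplex" for x :: "real^'n"
    using that zero_notin_std_simplex by auto
  have sup: "(SUP P\<in>wasserstein_ball \<theta> p ?E. ereal (\<integral>Q. quad_form Q x \<partial>P)) = ereal (quad_form ?A x)"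
    if "x \<in> std_simplex" for x
    using nonzero[OF that] assms(3,4) emp
    by (simp add: SUP_expectation_quad_form_on_ball quad_form_add_scaled_identity)
  obtain y where y: "y \<in> std_simplex" "\<forall>x\<in>std_simplex. quad_form ?A y \<le> quad_form ?A x"
    using quad_form_attains_min_on_std_simplex by blast
  have "(INF x\<in>std_simplex. SUP P\<in>wasserstein_ball \<theta> p ?E. ereal (\<integral>Q. quad_form Q x \<partial>P))
      = (INF x\<in>std_simplex. ereal (quad_form ?A x))"
    using sup by (rule INF_cong[OF refl])
  also have "\<dots> = ereal (quad_form ?A y)"
    using y by (intro antisym INF_lower INF_greatest) auto
  finally have inf: "(INF x\<in>std_simplex. SUP P\<in>wasserstein_ball \<theta> p ?E.
      ereal (\<integral>Q. quad_form Q x \<partial>P)) = ereal (quad_form ?A y)" .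
  have attained: "distr ?E sym_borel (worst_case_map \<theta> x) \<in> wasserstein_ball \<theta> p ?E \<and>
      ereal (\<integral>Q. quad_form Q x \<partial>distr ?E sym_borel (worst_case_map \<theta> x))
        = (SUP P\<in>wasserstein_ball \<theta> p ?E. ereal (\<integral>Q. quad_form Q x \<partial>P))"
    if "x \<in> std_simplex" for x
    using nonzero[OF that] assms(3,4) emp sup[OF that]
    by (simp add: worst_case_in_ball integral_quad_form_worst_case quad_form_add_scaled_identity)
  show ?thesis
    using y inf attained by blast
qed

end
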